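(* Assume Martin's Axiom and the negation of the Continuum Hypothesis. Let $(M,d)$ be a separable metric space such that for every countable ordinal $\alpha<\omega_1$ the metric space $(\mathrm{S}_\alpha(\mathbb{Z}),d_\infty)$ coarsely embeds into $(M,d)$. Then every separable metric space coarsely embeds into $(M,d)$.
   Context: Schreier families $\mathrm{S}_\alpha\subset[\mathbb{N}]^{<\omega}$, $\alpha<\omega_1$ (where $[\mathbb{N}]^{<\omega}$ is the set of finite subsets of $\mathbb{N}$, and $n\le A<B$ means $n\le\min A\le\max A<\min B$): $\mathrm{S}_0=\{\{n\}:n\in\mathbb{N}\}$; $\mathrm{S}_{\alpha+1}=\{\bigcup_{j=1}^n E_j: n\in\mathbb{N}, E_j\in\mathrm{S}_\alpha, n\le E_1<\dots<E_n\}$; for limit $\beta$ with a fixed sequence $(\alpha_n)$ increasing to $\beta$, $\mathrm{S}_\beta=\{A:\exists n,\ n\le A,\ A\in\mathrm{S}_{\alpha_n}\}$. $\mathrm{S}_\alpha(\mathbb{Z})=\{\sum_{i\in G}c_ie_i: G\in\mathrm{S}_\alpha, c_i\in\mathbb{Z}\}\subset c_{00}$ with the sup-norm metric $d_\infty$. A map $f:X\to Y$ is a coarse embedding if there are non-decreasing $\rho,\omega:[0,\infty)\to[0,\infty)$ with $\lim_{t\to\infty}\rho(t)=\infty$ and $\rho(d_X(x,y))\le d_Y(f(x),f(y))\le\omega(d_X(x,y))$ for all $x,y$. *)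

theory Defs
  imports "HOL-Analysis.Analysis" "HOL-Library.Equipollence"
begin

text \<open>Posets are carried by subsets of the reals (every poset of size at most the
continuum is isomorphic to one of these; MA restricted to such posets is equivalent
to full MA).\<close>

definition compatible :: "'p set \<Rightarrow> ('p \<Rightarrow> 'p \<Rightarrow> bool) \<Rightarrow> 'p \<Rightarrow> 'p \<Rightarrow> bool" where
  "compatible P le x y \<longleftrightarrow> (\<exists>z\<in>P. le z x \<and> le z y)"

definition antichain :: "'p set \<Rightarrow> ('p \<Rightarrow> 'p \<Rightarrow> bool) \<Rightarrow> 'p set \<Rightarrow> bool" where
  "antichain P le A \<longleftrightarrow> A \<subseteq> P \<and> (\<forall>x\<in>A. \<forall>y\<in>A. x \<noteq> y \<longrightarrow> \<not> compatible P le x y)"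

definition poset_on :: "'p set \<Rightarrow> ('p \<Rightarrow> 'p \<Rightarrow> bool) \<Rightarrow> bool" where
  "poset_on P le \<longleftrightarrow> (\<forall>x\<in>P. le x x) \<and>
     (\<forall>x\<in>P. \<forall>y\<in>P. \<forall>z\<in>P. le x y \<longrightarrow> le y z \<longrightarrow> le x z) \<and>
     (\<forall>x\<in>P. \<forall>y\<in>P. le x y \<longrightarrow> le y x \<longrightarrow> x = y)"

definition ccc :: "'p set \<Rightarrow> ('p \<Rightarrow> 'p \<Rightarrow> bool) \<Rightarrow> bool" where
  "ccc P le \<longleftrightarrow> (\<forall>A. antichain P le A \<longrightarrow> countable A)"

definition dense_in :: "'p set \<Rightarrow> ('p \<Rightarrow> 'p \<Rightarrow> bool) \<Rightarrow> 'p set \<Rightarrow> bool" where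
  "dense_in P le D \<longleftrightarrow> D \<subseteq> P \<and> (\<forall>p\<in>P. \<exists>q\<in>D. le q p)"

definition poset_filter :: "'p set \<Rightarrow> ('p \<Rightarrow> 'p \<Rightarrow> bool) \<Rightarrow> 'p set \<Rightarrow> bool" where
  "poset_filter P le G \<longleftrightarrow> G \<subseteq> P \<and> G \<noteq> {} \<and>
     (\<forall>p\<in>G. \<forall>q\<in>P. le p q \<longrightarrow> q \<in> G) \<and>
     (\<forall>p\<in>G. \<forall>q\<in>G. \<exists>r\<in>G. le r p \<and> le r q)"

definition martins_axiom :: bool where
  "martins_axiom \<longleftrightarrow>
     (\<forall>(P :: real set) le (\<D> :: real set set).
        poset_on P le \<and> P \<noteq> {} \<and> ccc P le \<and> (\<forall>D\<in>\<D>. dense_in P le D) \<and>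
        \<D> \<prec> (UNIV :: real set)
        \<longrightarrow> (\<exists>G. poset_filter P le G \<and> (\<forall>D\<in>\<D>. G \<inter> D \<noteq> {})))"

definition omega1_type :: "'o::wellorder itself \<Rightarrow> bool" where
  "omega1_type _ \<longleftrightarrow> uncountable (UNIV :: 'o set) \<and> (\<forall>\<beta>::'o. countable {\<alpha>. \<alpha> < \<beta>})"

definition is_limit :: "'o::wellorder \<Rightarrow> bool" where
  "is_limit \<beta> \<longleftrightarrow> (\<exists>\<alpha>. \<alpha> < \<beta>) \<and> (\<forall>\<alpha><\<beta>. \<exists>\<gamma>. \<alpha> < \<gamma> \<and> \<gamma> < \<beta>)"

text \<open>fs assigns to each limit beta a strictly increasing sequence (fs beta 1, fs beta 2, ...)
  converging to beta (index 0 is unused, matching the indexing n in N = {1,2,...}).\<close>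
definition fundamental_sequences :: "('o::wellorder \<Rightarrow> nat \<Rightarrow> 'o) \<Rightarrow> bool" where
  "fundamental_sequences fs \<longleftrightarrow> (\<forall>\<beta>. is_limit \<beta> \<longrightarrow>
     (\<forall>n\<ge>1. fs \<beta> n < fs \<beta> (Suc n) \<and> fs \<beta> n < \<beta>) \<and>
     (\<forall>\<alpha><\<beta>. \<exists>n\<ge>1. \<alpha> < fs \<beta> n))"

definition pred_ord :: "'o::wellorder \<Rightarrow> 'o" where
  "pred_ord \<alpha> = (THE \<gamma>. \<gamma> < \<alpha> \<and> (\<forall>\<delta><\<alpha>. \<delta> \<le> \<gamma>))"

text \<open>N = {1,2,...}; for finite nonempty sets, n <= A means n <= min A, A < B means max A < min B.\<close>

definition schreier_succ :: "nat set set \<Rightarrow> nat set set" where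
  "schreier_succ F = {A. \<exists>n\<ge>1. \<exists>E :: nat \<Rightarrow> nat set.
      (\<forall>j\<in>{1..n}. E j \<in> F) \<and> n \<le> Min (E 1) \<and>
      (\<forall>j\<in>{1..<n}. Max (E j) < Min (E (Suc j))) \<and>
      A = (\<Union>j\<in>{1..n}. E j)}"

definition schreier_step :: "('o::wellorder \<Rightarrow> nat \<Rightarrow> 'o) \<Rightarrow> ('o \<Rightarrow> nat set set) \<Rightarrow> 'o \<Rightarrow> nat set set" where
  "schreier_step fs S \<alpha> =
     (if \<not> (\<exists>\<gamma>. \<gamma> < \<alpha>) then {{n} | n. n \<ge> 1}
      else if is_limit \<alpha> then {A. \<exists>n\<ge>1. A \<in> S (fs \<alpha> n) \<and> n \<le> Min A}
      else schreier_succ (S (pred_ord \<alpha>)))"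

definition schreier :: "('o::wellorder \<Rightarrow> nat \<Rightarrow> 'o) \<Rightarrow> 'o \<Rightarrow> nat set set" where
  "schreier fs = wfrec {(x, y). x < y} (schreier_step fs)"

definition schreier_Z :: "('o::wellorder \<Rightarrow> nat \<Rightarrow> 'o) \<Rightarrow> 'o \<Rightarrow> (nat \<Rightarrow> int) set" where
  "schreier_Z fs \<alpha> = {x. \<exists>G\<in>schreier fs \<alpha>. \<forall>i. i \<notin> G \<longrightarrow> x i = 0}"

definition d_inf :: "(nat \<Rightarrow> int) \<Rightarrow> (nat \<Rightarrow> int) \<Rightarrow> real" where
  "d_inf x y = real_of_int (Max (range (\<lambda>i. \<bar>x i - y i\<bar>)))"

definition coarse_embedding ::
  "'a set \<Rightarrow> ('a \<Rightarrow> 'a \<Rightarrow> real) \<Rightarrow> 'b set \<Rightarrow> ('b \<Rightarrow> 'b \<Rightarrow> real) \<Rightarrow> ('a \<Rightarrow> 'b) \<Rightarrow> bool" where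
  "coarse_embedding X dX Y dY f \<longleftrightarrow> f ` X \<subseteq> Y \<and>
     (\<exists>\<rho> \<omega> :: real \<Rightarrow> real.
        mono_on {0..} \<rho> \<and> mono_on {0..} \<omega> \<and>
        (\<forall>t\<ge>0. \<rho> t \<ge> 0 \<and> \<omega> t \<ge> 0) \<and>
        filterlim \<rho> at_top at_top \<and>
        (\<forall>x\<in>X. \<forall>y\<in>X. \<rho> (dX x y) \<le> dY (f x) (f y) \<and> dY (f x) (f y) \<le> \<omega> (dX x y)))"

definition coarsely_embeds ::
  "'a set \<Rightarrow> ('a \<Rightarrow> 'a \<Rightarrow> real) \<Rightarrow> 'b set \<Rightarrow> ('b \<Rightarrow> 'b \<Rightarrow> real) \<Rightarrow> bool" where
  "coarsely_embeds X dX Y dY \<longleftrightarrow> (\<exists>f. coarse_embedding X dX Y dY f)"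

definition separable_metric_space :: "'a set \<Rightarrow> ('a \<Rightarrow> 'a \<Rightarrow> real) \<Rightarrow> bool" where
  "separable_metric_space M d \<longleftrightarrow> Metric_space M d \<and> separable_space (Metric_space.mtopology M d)"

end

theory Submission
  imports Defs
begin

text \<open>Under MA and the negation of CH, every family of \<^term>\<open>\<omega>\<^sub>1\<close> functions on the natural
  numbers is eventually dominated by one function, so uncountably many of the embeddings of the
  Schreier spaces share their moduli, and after a perturbation take values in a countable net
  of the target. The finite partial embeddings with these moduli form a countable tree. It
  contains, for uncountably many \<^term>\<open>\<alpha>\<close>, a copy of the tree of Schreier sets of order
  \<^term>\<open>\<alpha>\<close>, so it has no countable rank and hence an infinite branch: the finitely supported
  integer sequences embed coarsely into the target. By a coarse version of Aharoni's theorem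
  every separable metric space embeds coarsely into these sequences.\<close>

subsection \<open>Domination under Martin's axiom\<close>

text \<open>\<open>martins_axiom\<close> speaks of posets on sets of reals only. An injection of the
  type into the reals carries the order, the antichains and the dense sets over, and the filter is
  pulled back along it.\<close>

lemma martins_axiom_transfer:
  fixes le :: "'p \<Rightarrow> 'p \<Rightarrow> bool" and \<D> :: "'p set set"
  assumes MA: "martins_axiom"
    and size: "(UNIV :: 'p set) \<lesssim> (UNIV :: real set)"
    and po: "poset_on UNIV le" and ccc: "ccc UNIV le"
    and dense: "\<And>D. D \<in> \<D> \<Longrightarrow> dense_in UNIV le D"
    and few: "\<D> \<prec> (UNIV :: real set)"
  obtains G where "poset_filter UNIV le G" "\<And>D. D \<in> \<D> \<Longrightarrow> G \<inter> D \<noteq> {}"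
proof -
  obtain c :: "'p \<Rightarrow> real" where c: "inj c"
    using size unfolding lepoll_def by auto
  define le' where "le' x y \<longleftrightarrow> le (inv c x) (inv c y)" for x y
  have le': "le' (c p) (c q) \<longleftrightarrow> le p q" for p q
    using c by (simp add: le'_def)
  have comp: "compatible (range c) le' (c p) (c q) \<longleftrightarrow> compatible UNIV le p q" for p q
    by (auto simp: compatible_def le')
  have "poset_on (range c) le'"
    using po c unfolding poset_on_def by (simp add: le' inj_eq)
  moreover have "ccc (range c) le'"
    unfolding ccc_def
  proof (intro allI impI)
    fix A assume A: "antichain (range c) le' A"
    then have "A = c ` (c -` A)" 
      unfolding antichain_def by auto
    moreover have "antichain UNIV le (c -` A)"
      using A c unfolding antichain_def by (auto simp: comp[symmetric] inj_eq)
    ultimately show "countable A"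
      using ccc unfolding ccc_def by (metis countable_image)
  qed
  moreover have "\<forall>D \<in> (`) c ` \<D>. dense_in (range c) le' D"
    using dense unfolding dense_in_def by (fastforce simp: le')
  moreover have "(`) c ` \<D> \<prec> (UNIV :: real set)"
    using few image_lepoll lesspoll_trans1 by blast
  ultimately obtain G where G: "poset_filter (range c) le' G"
    and meet: "\<forall>D \<in> (`) c ` \<D>. G \<inter> D \<noteq> {}"
    using MA[unfolded martins_axiom_def, rule_format, of "range c" le' "(`) c ` \<D>"] by auto
  have "poset_filter UNIV le (c -` G)"
    unfolding poset_filter_def
  proof (intro conjI ballI impI)
    have sub: "G \<subseteq> range c" using G by (simp add: poset_filter_def)
    then show "c -` G \<noteq> {}" using G unfolding poset_filter_def by blast
    show "q \<in> c -` G" if "p \<in> c -` G" "le p q" for p q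
      using that G le' unfolding poset_filter_def by blast
    show "\<exists>r\<in>c -` G. le r p \<and> le r q" if pq: "p \<in> c -` G" "q \<in> c -` G" for p q
    proof -
      obtain z where "z \<in> G" "le' z (c p)" "le' z (c q)"
        using pq G unfolding poset_filter_def by blast
      moreover then obtain r where "z = c r" using sub by blast
      ultimately show ?thesis using le' by blast
    qed
  qed simp
  moreover have "c -` G \<inter> D \<noteq> {}" if "D \<in> \<D>" for D
    using bspec[OF meet imageI[OF that]] by auto
  ultimately show ?thesis using that by blast
qed

text \<open>A pair is coded by the graph of its function, with the number repeated in every element,
  so that both components can be read off the set.\<close>

lemma nat_fun_lepoll_real: "(UNIV :: (nat \<times> (nat \<Rightarrow> nat)) set) \<lesssim> (UNIV :: real set)"
proof -
  define code :: "nat \<times> (nat \<Rightarrow> nat) \<Rightarrow> nat set"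
    where "code p = range (\<lambda>i. prod_encode (fst p, prod_encode (i, snd p i)))" for p
  have "inj code"
  proof (rule injI)
    fix p q assume eq: "code p = code q"
    have "fst p = fst q \<and> snd p i = snd q i" for i
    proof -
      have "prod_encode (fst p, prod_encode (i, snd p i)) \<in> code p"
        by (simp add: code_def)
      then show ?thesis
        unfolding eq by (auto simp: code_def prod_encode_eq)
    qed
    then show "p = q" by (simp add: prod_eq_iff fun_eq_iff)
  qed
  then have "(UNIV :: (nat \<times> (nat \<Rightarrow> nat)) set) \<lesssim> (UNIV :: nat set set)"
    unfolding lepoll_def by auto
  also have "\<dots> \<lesssim> (UNIV :: real set)"
    by (meson nat_sets_lepoll_reals01 lepoll_trans subset_UNIV subset_imp_lepoll)
  finally show ?thesis .
qed

text \<open>Hechler forcing: a condition \<^term>\<open>(n, f)\<close> fixes the values of the generic function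
  below \<^term>\<open>n\<close> to be those of \<^term>\<open>f\<close>, and promises that it stays above \<^term>\<open>f\<close> afterwards.\<close>

definition hechler :: "nat \<times> (nat \<Rightarrow> nat) \<Rightarrow> nat \<times> (nat \<Rightarrow> nat) \<Rightarrow> bool" where
  "hechler p q \<longleftrightarrow> fst q \<le> fst p \<and> (\<forall>i<fst q. snd p i = snd q i) \<and> (\<forall>i. snd q i \<le> snd p i)"

lemma poset_on_hechler: "poset_on UNIV hechler"
  unfolding poset_on_def hechler_def
  by (auto simp: fun_eq_iff intro: order_trans antisym)

text \<open>Conditions with the same stem have the pointwise maximum as a common extension, so an
  antichain has at most one condition for each finite list of naturals.\<close>

lemma ccc_hechler: "ccc UNIV hechler"
  unfolding ccc_def
proof (intro allI impI)
  fix A assume A: "antichain UNIV hechler A"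
  have "inj_on (\<lambda>(n, f). map f [0..<n]) A"
  proof (rule inj_onI, clarify)
    fix n f m g assume nf: "(n, f) \<in> A" "(m, g) \<in> A" and eq: "map f [0..<n] = map g [0..<m]"
    have nm: "n = m" using arg_cong[OF eq, of length] by simp
    have "f i = g i" if "i < n" for i
      using arg_cong[OF eq, of "\<lambda>xs. xs ! i"] that nm by simp
    then have "hechler (n, \<lambda>i. max (f i) (g i)) (n, f)" "hechler (n, \<lambda>i. max (f i) (g i)) (m, g)"
      using nm by (auto simp: hechler_def)
    then have "compatible UNIV hechler (n, f) (m, g)"
      unfolding compatible_def by blast
    then show "n = m \<and> f = g"
      using A nf unfolding antichain_def by blast
  qed
  then show "countable A"
    by (meson countableI_type countable_image_inj_on countable_subset subset_UNIV)
qed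

text \<open>A filter meeting all \<open>D a\<close> glues to one function, whose value at
  \<open>i\<close> is read off a condition with stem longer than \<open>i\<close>. By
  \<open>small\<close> the dense sets are fewer than the continuum.\<close>

proposition martins_axiom_dominating:
  fixes g :: "'i \<Rightarrow> nat \<Rightarrow> nat"
  assumes MA: "martins_axiom" and inf: "infinite (UNIV :: 'i set)"
    and small: "\<not> (UNIV :: real set) \<lesssim> (UNIV :: 'i set)"
  obtains h where "\<And>a. \<exists>N. \<forall>n\<ge>N. g a n \<le> h n"
proof -
  \<comment> \<open>The surjection lets one family indexed by \<open>'i\<close> do two jobs:
    \<open>D a\<close> dominates \<open>g a\<close> and also forces stems of length at least
    \<open>e a\<close>.\<close>
  obtain e :: "'i \<Rightarrow> nat" where e: "surj e"
    using inf unfolding infinite_iff_countable_subset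
    by (metis inj_imp_surj_inv)
  define D where "D a = {(n, f). e a \<le> n \<and> (\<forall>i\<ge>n. g a i \<le> f i)}" for a
  have few: "range D \<prec> (UNIV :: real set)"
  proof -
    have "\<not> (UNIV :: real set) \<lesssim> range D"
      using small image_lepoll lepoll_trans by blast
    then have "range D \<lesssim> (UNIV :: real set)"
      unfolding lepoll_def card_of_ordLeq
      using ordLeq_total[OF card_of_Well_order card_of_Well_order] by blast
    with \<open>\<not> (UNIV :: real set) \<lesssim> range D\<close> show ?thesis
      by (meson lesspoll_def eqpoll_imp_lepoll eqpoll_sym)
  qed
  have dense: "dense_in UNIV hechler (D a)" for a
    unfolding dense_in_def
  proof (intro conjI ballI)
    fix p :: "nat \<times> (nat \<Rightarrow> nat)"
    obtain n f where p: "p = (n, f)" by fastforce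
    have "(max n (e a), \<lambda>i. if i < n then f i else max (f i) (g a i)) \<in> D a"
      by (auto simp: D_def)
    moreover have "hechler (max n (e a), \<lambda>i. if i < n then f i else max (f i) (g a i)) p"
      by (auto simp: hechler_def p)
    ultimately show "\<exists>q\<in>D a. hechler q p" by blast
  qed auto
  have "\<And>E. E \<in> range D \<Longrightarrow> dense_in UNIV hechler E" using dense by blast
  from martins_axiom_transfer[OF MA nat_fun_lepoll_real poset_on_hechler ccc_hechler this few]
  obtain G where G: "poset_filter UNIV hechler G"
    and "\<And>E. E \<in> range D \<Longrightarrow> G \<inter> E \<noteq> {}" by blast
  then have meet: "G \<inter> D a \<noteq> {}" for a by blast
  have "\<exists>p\<in>G. i < fst p" for i
  proof -
    obtain a where "e a = Suc i" using e by (metis surjD)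
    with meet[of a] show ?thesis by (force simp: D_def Suc_le_eq)
  qed
  then obtain P where P: "\<And>i. P i \<in> G" "\<And>i. i < fst (P i)" by metis
  have "\<exists>N. \<forall>i\<ge>N. g a i \<le> snd (P i) i" for a
  proof -
    obtain q where q: "q \<in> G" "q \<in> D a" using meet by blast
    have "g a i \<le> snd (P i) i" if "fst q \<le> i" for i
    proof -
      \<comment> \<open>\<open>r\<close> agrees with \<open>P i\<close> at \<open>i\<close>, which
        lies within the stem of \<open>P i\<close>, and keeps the promise made by
        \<open>q\<close>.\<close>
      obtain r where r: "hechler r q" "hechler r (P i)"
        using G q(1) P(1)[of i] unfolding poset_filter_def by blast
      have "g a i \<le> snd q i" using q(2) that by (auto simp: D_def)
      also have "\<dots> \<le> snd r i" using r(1) by (simp add: hechler_def)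
      also have "\<dots> = snd (P i) i" using r(2) P(2)[of i] by (simp add: hechler_def)
      finally show ?thesis .
    qed
    then show ?thesis by blast
  qed
  then show ?thesis using that[of "\<lambda>i. snd (P i) i"] by blast
qed

subsection \<open>Moduli of coarse embeddings\<close>

text \<open>One integer function bounds the expansion and inverts the lower modulus, so that both
  moduli are dominated at once by dominating a single element of
  \<open>nat \<Rightarrow> nat\<close>.\<close>

definition coarsely_controlled ::
  "'a set \<Rightarrow> ('a \<Rightarrow> 'a \<Rightarrow> real) \<Rightarrow> ('b \<Rightarrow> 'b \<Rightarrow> real) \<Rightarrow> ('a \<Rightarrow> 'b) \<Rightarrow> (nat \<Rightarrow> nat) \<Rightarrow> bool" where
  "coarsely_controlled X dX dY f g \<longleftrightarrow> (\<forall>x\<in>X. \<forall>y\<in>X. \<forall>n.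
     (dX x y \<le> real n \<longrightarrow> dY (f x) (f y) \<le> real (g n)) \<and>
     (real (g n) \<le> dX x y \<longrightarrow> real n \<le> dY (f x) (f y)))"

lemma coarsely_controlled_mono:
  assumes "coarsely_controlled X dX dY f g" "\<And>n. g n \<le> h n" "X' \<subseteq> X"
  shows "coarsely_controlled X' dX dY f h"
  unfolding coarsely_controlled_def
proof (intro ballI allI)
  fix x y n assume xy: "x \<in> X'" "y \<in> X'"
  have "real (g n) \<le> real (h n)" using assms(2) by simp
  then show "(dX x y \<le> real n \<longrightarrow> dY (f x) (f y) \<le> real (h n)) \<and>
     (real (h n) \<le> dX x y \<longrightarrow> real n \<le> dY (f x) (f y))"
    using assms(1,3) xy unfolding coarsely_controlled_def by (meson order_trans subsetD)
qed

lemma coarsely_controlled_cong: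
  assumes "coarsely_controlled X dX dY f g" "\<And>x. x \<in> X \<Longrightarrow> f x = f' x"
  shows "coarsely_controlled X dX dY f' g"
  using assms unfolding coarsely_controlled_def by simp

lemma coarsely_controlled_comp:
  assumes f: "coarsely_controlled X dX dY f g" and f': "coarsely_controlled Y dY dZ f' g'"
    and "f ` X \<subseteq> Y"
  shows "coarsely_controlled X dX dZ (f' \<circ> f) (\<lambda>n. max (g' (g n)) (g (g' n)))"
  unfolding coarsely_controlled_def o_def
proof (intro ballI allI conjI impI)
  fix x y n assume xy: "x \<in> X" "y \<in> X"
  then have Y: "f x \<in> Y" "f y \<in> Y" using assms(3) by auto
  { assume "dX x y \<le> real n"
    then have "dY (f x) (f y) \<le> real (g n)" using f xy unfolding coarsely_controlled_def by blast
    then have "dZ (f' (f x)) (f' (f y)) \<le> real (g' (g n))"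
      using f' Y unfolding coarsely_controlled_def by blast
    then show "dZ (f' (f x)) (f' (f y)) \<le> real (max (g' (g n)) (g (g' n)))" by linarith }
  { assume "real (max (g' (g n)) (g (g' n))) \<le> dX x y"
    then have "real (g (g' n)) \<le> dX x y" by linarith
    then have "real (g' n) \<le> dY (f x) (f y)" using f xy unfolding coarsely_controlled_def by blast
    then show "real n \<le> dZ (f' (f x)) (f' (f y))"
      using f' Y unfolding coarsely_controlled_def by blast }
qed

text \<open>Moving both endpoints by less than 1 changes a distance by less than 2, which accounts
  for both shifts.\<close>

lemma (in Metric_space) coarsely_controlled_perturb:
  assumes f: "coarsely_controlled X dX d f g"
    and M: "\<And>x. x \<in> X \<Longrightarrow> f x \<in> M \<and> f' x \<in> M" and near: "\<And>x. x \<in> X \<Longrightarrow> d (f x) (f' x) < 1"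
  shows "coarsely_controlled X dX d f' (\<lambda>n. max (g n + 2) (g (n + 2)))"
  unfolding coarsely_controlled_def
proof (intro ballI allI conjI impI)
  fix x y n assume xy: "x \<in> X" "y \<in> X"
  have "\<bar>d (f x) (f y) - d (f' x) (f' y)\<bar> < 2"
    using near[OF xy(1)] near[OF xy(2)] M[OF xy(1)] M[OF xy(2)]
      triangle[of "f x" "f' x" "f y"] triangle[of "f' x" "f' y" "f y"]
      triangle[of "f' x" "f x" "f' y"] triangle[of "f x" "f y" "f' y"]
      commute[of "f x" "f' x"] commute[of "f y" "f' y"] by linarith
  moreover have "dX x y \<le> real n \<Longrightarrow> d (f x) (f y) \<le> real (g n)"
    and "real (g (n + 2)) \<le> dX x y \<Longrightarrow> real (n + 2) \<le> d (f x) (f y)"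
    using f xy unfolding coarsely_controlled_def by blast+
  ultimately show "dX x y \<le> real n \<Longrightarrow> d (f' x) (f' y) \<le> real (max (g n + 2) (g (n + 2)))"
    and "real (max (g n + 2) (g (n + 2))) \<le> dX x y \<Longrightarrow> real n \<le> d (f' x) (f' y)"
    by (force simp: max_def split: if_splits)+
qed

lemma coarse_embedding_imp_controlled:
  assumes "coarse_embedding X dX Y dY f" and "X' \<subseteq> X"
    and nonneg: "\<And>x y. \<lbrakk>x \<in> X'; y \<in> X'\<rbrakk> \<Longrightarrow> 0 \<le> dX x y"
  obtains g where "coarsely_controlled X' dX dY f g"
proof -
  obtain \<rho> \<omega> :: "real \<Rightarrow> real" where \<omega>: "mono_on {0..} \<omega>"
    and lim: "filterlim \<rho> at_top at_top"
    and bd: "\<And>x y. \<lbrakk>x \<in> X'; y \<in> X'\<rbrakk> \<Longrightarrow> \<rho> (dX x y) \<le> dY (f x) (f y) \<and> dY (f x) (f y) \<le> \<omega> (dX x y)"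
    using assms(1,2) unfolding coarse_embedding_def by (meson subsetD)
  have "\<exists>m. \<forall>t\<ge>real m. real n \<le> \<rho> t" for n
  proof -
    obtain N where "\<And>t. t \<ge> N \<Longrightarrow> real n \<le> \<rho> t"
      using lim unfolding filterlim_at_top eventually_at_top_linorder by blast
    then show ?thesis by (metis order_trans real_arch_simple)
  qed
  then obtain s where s: "\<And>n t. t \<ge> real (s n) \<Longrightarrow> real n \<le> \<rho> t" by metis
  have "\<exists>m. \<omega> (real n) \<le> real m" for n by (rule real_arch_simple)
  then obtain u where u: "\<And>n. \<omega> (real n) \<le> real (u n)" by metis
  have "coarsely_controlled X' dX dY f (\<lambda>n. max (u n) (s n))"
    unfolding coarsely_controlled_def
  proof (intro ballI allI conjI impI)
    fix x y n assume xy: "x \<in> X'" "y \<in> X'"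
    { assume "dX x y \<le> real n"
      then have "\<omega> (dX x y) \<le> \<omega> (real n)"
        using \<omega> nonneg[OF xy] by (auto intro: mono_onD)
      then show "dY (f x) (f y) \<le> real (max (u n) (s n))"
        using bd[OF xy] u[of n] by linarith }
    { assume "real (max (u n) (s n)) \<le> dX x y"
      then have "real n \<le> \<rho> (dX x y)" by (intro s) linarith
      then show "real n \<le> dY (f x) (f y)" using bd[OF xy] by linarith }
  qed
  then show ?thesis using that by blast
qed

lemma controlled_imp_coarse_embedding:
  assumes f: "coarsely_controlled X dX dY f g" and Y: "f ` X \<subseteq> Y"
    and nonneg: "\<And>x y. \<lbrakk>x \<in> X; y \<in> X\<rbrakk> \<Longrightarrow> 0 \<le> dX x y \<and> 0 \<le> dY (f x) (f y)"
  shows "coarse_embedding X dX Y dY f"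
proof -
  \<comment> \<open>\<open>\<rho> t\<close> is the largest \<open>k\<close> whose threshold
    \<open>g k\<close> is at most \<open>t\<close>. Demanding \<open>k \<le> t\<close> as well keeps
    \<open>K t\<close> finite; the default 0 keeps it nonempty and is harmless as distances are
    nonnegative.\<close>
  define K where "K t = {k. k = 0 \<or> real (max k (g k)) \<le> t}" for t :: real
  define \<rho> where "\<rho> t = real (Max (K t))" for t
  \<comment> \<open>Summing makes the modulus monotone even if \<open>g\<close> is not.\<close>
  define \<omega> where "\<omega> t = (\<Sum>k\<le>nat \<lceil>t\<rceil>. real (g k))" for t :: real
  have fin: "finite (K t)" for t
  proof (rule finite_subset)
    show "K t \<subseteq> {..nat \<lceil>t\<rceil>}" unfolding K_def by auto linarith
  qed simp
  have zero: "0 \<in> K t" for t by (simp add: K_def)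
  have "mono_on {0..} \<rho>"
    unfolding \<rho>_def
  proof (intro mono_onI of_nat_mono Max_mono fin)
    show "K s \<subseteq> K t" if "s \<le> t" for s t using that by (auto simp: K_def)
    show "K t \<noteq> {}" for t using zero by auto
  qed
  moreover have "mono_on {0..} \<omega>"
    unfolding \<omega>_def by (intro mono_onI sum_mono2 iffD2[OF atMost_subset_iff] nat_mono ceiling_mono) auto
  moreover have "filterlim \<rho> at_top at_top"
    unfolding filterlim_at_top eventually_at_top_linorder
  proof (intro allI)
    fix Z :: real
    obtain k where k: "Z \<le> real k" using real_arch_simple by blast
    have "Z \<le> \<rho> t" if "t \<ge> real (max k (g k))" for t
    proof -
      have "k \<in> K t" using that by (auto simp: K_def)
      then have "k \<le> Max (K t)" by (simp add: fin)
      then show ?thesis using k by (simp add: \<rho>_def)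
    qed
    then show "\<exists>N. \<forall>t\<ge>N. Z \<le> \<rho> t" by blast
  qed
  moreover have "\<rho> (dX x y) \<le> dY (f x) (f y) \<and> dY (f x) (f y) \<le> \<omega> (dX x y)"
    if xy: "x \<in> X" "y \<in> X" for x y
  proof
    have "Max (K (dX x y)) \<in> K (dX x y)" using fin zero by (metis Max_in empty_iff)
    then show "\<rho> (dX x y) \<le> dY (f x) (f y)"
      using f xy nonneg[OF xy] unfolding K_def \<rho>_def coarsely_controlled_def by auto
    have "dX x y \<le> real (nat \<lceil>dX x y\<rceil>)" by (rule real_nat_ceiling_ge)
    then have "dY (f x) (f y) \<le> real (g (nat \<lceil>dX x y\<rceil>))"
      using f xy unfolding coarsely_controlled_def by blast
    also have "\<dots> \<le> \<omega> (dX x y)" unfolding \<omega>_def by (rule member_le_sum) auto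
    finally show "dY (f x) (f y) \<le> \<omega> (dX x y)" .
  qed
  moreover have "\<forall>t\<ge>0. \<rho> t \<ge> 0 \<and> \<omega> t \<ge> 0" by (simp add: \<rho>_def \<omega>_def sum_nonneg)
  ultimately show ?thesis unfolding coarse_embedding_def using Y by blast
qed

subsection \<open>Aharoni's theorem\<close>

definition c00 :: "(nat \<Rightarrow> int) set" where
  "c00 = {x. finite {i. x i \<noteq> 0}}"

text \<open>\<open>Max\<close> is informative on finite sets only; finite supports leave finitely
  many values for the differences.\<close>

lemma d_inf_le_iff:
  assumes "x \<in> c00" "y \<in> c00"
  shows "d_inf x y \<le> c \<longleftrightarrow> (\<forall>i. real_of_int \<bar>x i - y i\<bar> \<le> c)"
proof -
  have "range (\<lambda>i. \<bar>x i - y i\<bar>) \<subseteq> insert 0 ((\<lambda>i. \<bar>x i - y i\<bar>) ` ({i. x i \<noteq> 0} \<union> {i. y i \<noteq> 0}))"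
    by auto
  then have "finite (range (\<lambda>i. \<bar>x i - y i\<bar>))"
    by (rule finite_subset) (use assms in \<open>simp add: c00_def\<close>)
  then show ?thesis
    unfolding d_inf_def le_floor_iff[symmetric] by simp
qed

lemma le_d_inf:
  assumes "x \<in> c00" "y \<in> c00"
  shows "real_of_int \<bar>x i - y i\<bar> \<le> d_inf x y"
  using d_inf_le_iff[OF assms] by blast

lemma d_inf_nonneg:
  assumes "x \<in> c00" "y \<in> c00"
  shows "0 \<le> d_inf x y"
  using le_d_inf[OF assms, of 0] by (rule order_trans[rotated]) simp

lemma (in Metric_space) separable_net:
  assumes "separable_space mtopology"
  obtains C where "countable C" "C \<subseteq> M" "\<And>x e. \<lbrakk>x \<in> M; e > 0\<rbrakk> \<Longrightarrow> \<exists>c\<in>C. d x c < e"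
proof -
  obtain C where "countable C" "C \<subseteq> M" and C: "mtopology closure_of C = M"
    using assms unfolding separable_space_def by auto
  moreover have "\<exists>c\<in>C. d x c < e" if "x \<in> M" "e > 0" for x e
  proof -
    have "x \<in> mtopology closure_of C" using C that by simp
    then show ?thesis using that unfolding metric_closure_of by (auto simp: in_mball)
  qed
  ultimately show ?thesis using that by blast
qed

lemma floor_diff_bounds:
  fixes a b :: real
  shows "\<bar>a - b\<bar> - 1 \<le> real_of_int \<bar>\<lfloor>a\<rfloor> - \<lfloor>b\<rfloor>\<bar>" "real_of_int \<bar>\<lfloor>a\<rfloor> - \<lfloor>b\<rfloor>\<bar> \<le> \<bar>a - b\<bar> + 1"
  by linarith+

text \<open>A coarse version of Aharoni's theorem. At each scale \<^term>\<open>r\<close> the functions \<^term>\<open>\<psi> r i\<close>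
  are 1-Lipschitz, and if \<^term>\<open>i\<close> is the first index of the net with
  \<^term>\<open>c i\<close> at distance less than \<^term>\<open>2 * r\<close> from \<^term>\<open>x\<close>, then the coordinate \<^term>\<open>i\<close>
  separates \<^term>\<open>x\<close> from all points at distance at least \<^term>\<open>5 * r\<close>. Every point close to
  \<^term>\<open>c k\<close> is ignored by the coordinates after \<^term>\<open>k\<close>. The coordinate 0 has a form
  of its own, so that all coordinates at \<^term>\<open>x\<close> vanish at the scales beyond its distance
  to \<^term>\<open>c 0\<close>.\<close>

proposition (in Metric_space) aharoni_coarse:
  assumes "separable_space mtopology"
  obtains F where "F ` M \<subseteq> c00" "coarsely_controlled M d d_inf F (\<lambda>n. 5 * n + 5)"
proof (cases "M = {}")
  case True
  then show ?thesis using that by (auto simp: coarsely_controlled_def)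
next
  case False
  obtain C where C: "countable C" "C \<subseteq> M" "\<And>x e. \<lbrakk>x \<in> M; e > 0\<rbrakk> \<Longrightarrow> \<exists>c\<in>C. d x c < e"
    using separable_net[OF assms] by metis
  with False have "C \<noteq> {}" by (metis ex_in_conv zero_less_one)
  then obtain c :: "nat \<Rightarrow> 'a" where c: "range c = C"
    using C(1) range_from_nat_into by metis
  have net: "\<exists>k. d x (c k) < e" if "x \<in> M" "e > 0" for x e
    using C(3)[OF that] c by auto
  have cM: "c k \<in> M" for k using C(2) c by auto
  \<comment> \<open>A minimum of 1-Lipschitz functions. It is at least \<open>r\<close> if
    \<open>c i\<close> is the first net point closer than \<open>2 * r\<close>, and at most 0 if
    \<open>c i\<close> is at distance at least \<open>3 * r\<close>.\<close>
  define \<mu> where "\<mu> r i x = Min (insert (3 * r - d x (c i)) ((\<lambda>j. d x (c j) - r) ` {..<i}))" for r i x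
  have \<mu>: "t \<le> \<mu> r i x \<longleftrightarrow> t \<le> 3 * r - d x (c i) \<and> (\<forall>j<i. t \<le> d x (c j) - r)" for t r i x
    unfolding \<mu>_def by (subst Min_ge_iff) auto
  have \<mu>_le: "\<mu> r i x \<le> 3 * r - d x (c i)" "j < i \<Longrightarrow> \<mu> r i x \<le> d x (c j) - r" for r i j x
    using \<mu>[of "\<mu> r i x" r i x] by auto
  \<comment> \<open>At \<open>i = 0\<close> the minimum would reduce to
    \<open>3 * r - d x (c 0)\<close>, which is positive at all large scales.\<close>
  define \<psi> where "\<psi> r i x = max 0 (if i = 0 then d x (c 0) - r else \<mu> r i x)" for r i x
  have Lip_le: "\<mu> r i x - d x y \<le> \<mu> r i y" if "x \<in> M" "y \<in> M" for r i x y
  proof -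
    have "d x (c j) \<le> d x y + d y (c j)" "d y (c j) \<le> d x y + d x (c j)" for j
      using triangle[of x y "c j"] triangle[of y x "c j"] commute[of x y] that cM by auto
    note tri = this
    show ?thesis unfolding \<mu>
    proof (intro conjI allI impI)
      show "\<mu> r i x - d x y \<le> 3 * r - d y (c i)" using \<mu>_le(1)[of r i x] tri(2)[of i] by linarith
      show "\<mu> r i x - d x y \<le> d y (c j) - r" if "j < i" for j
        using \<mu>_le(2)[OF that, of r x] tri(1)[of j] by linarith
    qed
  qed
  have Lip: "\<bar>\<psi> r i x - \<psi> r i y\<bar> \<le> d x y" if "x \<in> M" "y \<in> M" for r i x y
    using Lip_le[OF that, of r i] Lip_le[OF that(2,1), of r i] commute[of x y]
      triangle[OF that cM[of 0]] triangle[OF that(2,1) cM[of 0]]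
    unfolding \<psi>_def by (auto simp: max_def split: if_splits)
  \<comment> \<open>Scale and net index share one coordinate. Scales start at 1, and rounding costs
    at most 1 in each difference.\<close>
  define F where "F x p = (case prod_decode p of (n, i) \<Rightarrow> \<lfloor>\<psi> (real n + 1) i x\<rfloor>)" for x p
  have F: "F x (prod_encode (n, i)) = \<lfloor>\<psi> (real n + 1) i x\<rfloor>" for x n i
    by (simp add: F_def)
  have F_c00: "F x \<in> c00" if x: "x \<in> M" for x
  proof -
    obtain k where k: "d x (c k) < 1" using net[OF x, of 1] by auto
    have "p \<in> prod_encode ` ({..nat \<lceil>d x (c 0)\<rceil>} \<times> {..k})" if "F x p \<noteq> 0" for p
    proof -
      obtain n i where p: "p = prod_encode (n, i)"
        by (metis prod_decode_inverse surj_pair)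
      have pos: "0 < \<psi> (real n + 1) i x"
        using that unfolding p F \<psi>_def by linarith
      have "i \<le> k"
      proof (rule ccontr)
        assume "\<not> i \<le> k"
        then have "\<mu> (real n + 1) i x \<le> d x (c k) - (real n + 1)" "i \<noteq> 0"
          using \<mu>_le(2) by auto
        then show False using k pos unfolding \<psi>_def by auto
      qed
      moreover have "n \<le> nat \<lceil>d x (c 0)\<rceil>"
      proof (rule ccontr)
        assume "\<not> n \<le> nat \<lceil>d x (c 0)\<rceil>"
        then have "d x (c 0) < real n + 1" by linarith
        moreover have "i \<noteq> 0 \<Longrightarrow> \<mu> (real n + 1) i x \<le> d x (c 0) - (real n + 1)"
          using \<mu>_le(2) by auto
        ultimately show False using pos unfolding \<psi>_def by (auto split: if_splits)
      qed
      ultimately show ?thesis unfolding p by blast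
    qed
    then have "{p. F x p \<noteq> 0} \<subseteq> prod_encode ` ({..nat \<lceil>d x (c 0)\<rceil>} \<times> {..k})" by blast
    then show ?thesis
      unfolding c00_def by (auto intro: finite_subset)
  qed
  have "coarsely_controlled M d d_inf F (\<lambda>n. 5 * n + 5)"
    unfolding coarsely_controlled_def
  proof (intro ballI allI conjI impI)
    fix x y n assume xy: "x \<in> M" "y \<in> M"
    note c00 = F_c00[OF xy(1)] F_c00[OF xy(2)]
    { assume n: "d x y \<le> real n"
      have "real_of_int \<bar>F x p - F y p\<bar> \<le> real (5 * n + 5)" for p
      proof -
        obtain m i where p: "p = prod_encode (m, i)"
          by (metis prod_decode_inverse surj_pair)
        show ?thesis
          using floor_diff_bounds(2)[of "\<psi> (real m + 1) i x" "\<psi> (real m + 1) i y"]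
            Lip[OF xy, of "real m + 1" i] n unfolding p F by simp
      qed
      then show "d_inf (F x) (F y) \<le> real (5 * n + 5)"
        using d_inf_le_iff[OF c00] by blast }
    { assume n: "real (5 * n + 5) \<le> d x y"
      define r where "r = real n + 1"
      \<comment> \<open>\<open>x\<close> will lie within \<open>2 * r\<close> of \<open>c i\<close>,
        which leaves \<open>3 * r\<close> for \<open>y\<close>. Since \<open>r = n + 1\<close>, a
        separation by \<open>r\<close> still leaves \<open>n\<close> after rounding.\<close>
      have far: "5 * r \<le> d x y" using n by (simp add: r_def)
      have "\<exists>i. d x (c i) < 2 * r" using net[OF xy(1), of "2 * r"] by (simp add: r_def)
      define i where "i = (LEAST i. d x (c i) < 2 * r)"
      have i: "d x (c i) < 2 * r" unfolding i_def using \<open>\<exists>i. d x (c i) < 2 * r\<close> by (rule LeastI_ex)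
      have j: "2 * r \<le> d x (c j)" if "j < i" for j
        using not_less_Least[of j "\<lambda>i. d x (c i) < 2 * r"] that unfolding i_def by auto
      have y: "3 * r \<le> d y (c i)"
        using i far triangle[OF xy(1) cM[of i] xy(2)] commute[of "c i" y] by linarith
      have "r \<le> \<bar>\<psi> r i x - \<psi> r i y\<bar>"
      proof (cases "i = 0")
        case True
        then show ?thesis using i y by (auto simp: \<psi>_def max_def)
      next
        case False
        have "r \<le> \<mu> r i x" unfolding \<mu> using i j by force
        moreover have "\<mu> r i y \<le> 0" using y \<mu>_le(1)[of r i y] by linarith
        ultimately show ?thesis using False by (simp add: \<psi>_def)
      qed
      then have "real n \<le> real_of_int \<bar>F x (prod_encode (n, i)) - F y (prod_encode (n, i))\<bar>"
        using floor_diff_bounds(1)[of "\<psi> r i x" "\<psi> r i y"] unfolding F r_def by linarith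
      also have "\<dots> \<le> d_inf (F x) (F y)" by (rule le_d_inf[OF c00])
      finally show "real n \<le> d_inf (F x) (F y)" . }
  qed
  with F_c00 show ?thesis using that by blast
qed

subsection \<open>The rank of the Schreier families\<close>

lemma schreier_least:
  assumes "\<And>\<gamma>. \<not> \<gamma> < \<alpha>"
  shows "schreier fs \<alpha> = {{n} | n. n \<ge> 1}"
  using assms unfolding schreier_def
  by (subst wfrec[OF wf]) (simp add: schreier_step_def)

lemma schreier_limit:
  assumes "fundamental_sequences fs" "is_limit \<alpha>"
  shows "schreier fs \<alpha> = {A. \<exists>n\<ge>1. A \<in> schreier fs (fs \<alpha> n) \<and> n \<le> Min A}"
proof -
  have "fs \<alpha> n < \<alpha>" if "n \<ge> 1" for n
    using assms that unfolding fundamental_sequences_def by blast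
  moreover have "\<exists>\<gamma>. \<gamma> < \<alpha>" using assms(2) unfolding is_limit_def by blast
  ultimately show ?thesis
    using assms(2) unfolding schreier_def
    by (subst wfrec[OF wf]) (auto simp: schreier_step_def cut_apply)
qed

lemma schreier_successor:
  assumes "\<gamma> < \<alpha>" "\<And>\<delta>. \<delta> < \<alpha> \<Longrightarrow> \<delta> \<le> \<gamma>"
  shows "schreier fs \<alpha> = schreier_succ (schreier fs \<gamma>)"
proof -
  have "pred_ord \<alpha> = \<gamma>"
    unfolding pred_ord_def using assms by (intro the_equality) (auto intro: antisym)
  moreover have "\<not> is_limit \<alpha>"
    using assms unfolding is_limit_def by (meson leD)
  moreover have "\<exists>\<gamma>. \<gamma> < \<alpha>" using assms(1) by blast
  ultimately show ?thesis
    using assms(1) unfolding schreier_def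
    by (subst wfrec[OF wf]) (simp add: schreier_step_def cut_apply)
qed

lemma wellorder_cases [case_names least limit successor]:
  fixes \<alpha> :: "'o::wellorder"
  obtains "\<And>\<gamma>. \<not> \<gamma> < \<alpha>"
  | "is_limit \<alpha>"
  | \<gamma> where "\<gamma> < \<alpha>" "\<And>\<delta>. \<delta> < \<alpha> \<Longrightarrow> \<delta> \<le> \<gamma>"
  unfolding is_limit_def by (metis not_le)

text \<open>Index 1 serves in both inductive cases, since \<open>1 \<le> m\<close> is the only
  condition it imposes.\<close>

lemma singleton_in_schreier:
  assumes fs: "fundamental_sequences fs" and "m \<ge> 1"
  shows "{m} \<in> schreier fs \<alpha>"
proof (induction \<alpha> rule: less_induct)
  case (less \<alpha>)
  show ?case
  proof (cases \<alpha> rule: wellorder_cases)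
    case least
    then show ?thesis using \<open>m \<ge> 1\<close> by (simp add: schreier_least)
  next
    case limit
    then have "fs \<alpha> 1 < \<alpha>" using fs unfolding fundamental_sequences_def by blast
    then show ?thesis using less.IH \<open>m \<ge> 1\<close> by (auto simp: schreier_limit[OF fs limit])
  next
    case (successor \<gamma>)
    have "\<exists>n\<ge>1. \<exists>E :: nat \<Rightarrow> nat set.
      (\<forall>j\<in>{1..n}. E j \<in> schreier fs \<gamma>) \<and> n \<le> Min (E 1) \<and>
      (\<forall>j\<in>{1..<n}. Max (E j) < Min (E (Suc j))) \<and> {m} = (\<Union>j\<in>{1..n}. E j)"
      using less.IH[OF successor(1)] \<open>m \<ge> 1\<close> by (intro exI[of _ 1] exI[of _ "\<lambda>_. {m}"]) auto
    then show ?thesis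
      by (simp add: schreier_successor[OF successor] schreier_succ_def)
  qed
qed

text \<open>The blocks are \<open>{m}\<close> and \<open>A\<close>; \<open>2 \<le> m\<close> is the
  admissibility condition for two blocks. This extra point raises the rank at successors.\<close>

lemma insert_in_schreier_succ:
  assumes "{m} \<in> F" "A \<in> F" "2 \<le> m" "m < Min A"
  shows "insert m A \<in> schreier_succ F"
proof -
  let ?E = "\<lambda>j::nat. if j = 1 then {m} else A"
  have two: "{1..2::nat} = {1, 2}" "{1..<2::nat} = {1}" by auto
  have "(\<forall>j\<in>{1..2}. ?E j \<in> F) \<and> 2 \<le> Min (?E 1) \<and>
      (\<forall>j\<in>{1..<2}. Max (?E j) < Min (?E (Suc j))) \<and> insert m A = (\<Union>j\<in>{1..2}. ?E j)"
    unfolding two using assms by simp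
  then show ?thesis unfolding schreier_succ_def by (intro CollectI exI[of _ 2] conjI exI[of _ ?E]) auto
qed

text \<open>The tree of Schreier sets of order \<^term>\<open>\<alpha>\<close>, ordered by inclusion, has rank at least \<^term>\<open>\<alpha>\<close>.
  The threshold \<^term>\<open>N\<close> makes the induction go through at successors.\<close>

proposition schreier_rank:
  fixes fs :: "'o::wellorder \<Rightarrow> nat \<Rightarrow> 'o" and \<Phi> :: "nat set \<Rightarrow> 'o"
  assumes fs: "fundamental_sequences fs"
    and dec: "\<And>s t. \<lbrakk>s \<in> schreier fs \<alpha>; t \<in> schreier fs \<alpha>; s \<noteq> {}; finite t; N \<le> Min t; s \<subset> t\<rbrakk>
      \<Longrightarrow> \<Phi> t < \<Phi> s"
    and "\<delta> < \<alpha>"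
  shows "\<exists>K. \<forall>m\<ge>K. \<delta> \<le> \<Phi> {m}"
  using dec \<open>\<delta> < \<alpha>\<close>
proof (induction \<alpha> arbitrary: N \<Phi> \<delta> rule: less_induct)
  case (less \<alpha>)
  have Min_sub: "Min t \<le> Min s" if "s \<noteq> {}" "finite t" "s \<subset> t" for s t :: "nat set"
    using that by (intro Min_antimono) auto
  show ?case
  proof (cases \<alpha> rule: wellorder_cases)
    case least
    then show ?thesis using less.prems(2) by blast
  next
    case limit
    then obtain n where n: "n \<ge> 1" "\<delta> < fs \<alpha> n" "fs \<alpha> n < \<alpha>"
      using fs less.prems(2) unfolding fundamental_sequences_def by blast
    \<comment> \<open>Raising the threshold to \<open>n\<close> places the sets of order
      \<open>fs \<alpha> n\<close> in the family of order \<open>\<alpha>\<close>.\<close>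
    show ?thesis
    proof (rule less.IH[OF n(3) _ n(2), where N = "max N n"])
      fix s t assume st: "s \<in> schreier fs (fs \<alpha> n)" "t \<in> schreier fs (fs \<alpha> n)" "s \<noteq> {}" "finite t"
        "max N n \<le> Min t" "s \<subset> t"
      then have "s \<in> schreier fs \<alpha>" "t \<in> schreier fs \<alpha>"
        using n(1) Min_sub[of s t] by (auto simp: schreier_limit[OF fs limit] intro!: exI[of _ n])
      then show "\<Phi> t < \<Phi> s" using less.prems(1) st by simp
    qed
  next
    case (successor \<gamma>)
    have S: "schreier fs \<alpha> = schreier_succ (schreier fs \<gamma>)"
      by (rule schreier_successor[OF successor])
    \<comment> \<open>If \<open>\<Phi> {m}\<close> were below \<open>\<gamma>\<close>, the induction
      hypothesis for \<open>\<lambda>s. \<Phi> (insert m s)\<close> on sets beyond \<open>m\<close>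
      would give \<open>\<Phi> {m} \<le> \<Phi> {m, m'}\<close> for large \<open>m'\<close>,
      although adding \<open>m'\<close> lowers the value.\<close>
    have "\<gamma> \<le> \<Phi> {m}" if m: "m \<ge> max 2 N" for m
    proof (rule ccontr)
      assume "\<not> \<gamma> \<le> \<Phi> {m}"
      have ins: "insert m s \<in> schreier fs \<alpha>" if "s \<in> schreier fs \<gamma>" "m < Min s" for s
        unfolding S using that m singleton_in_schreier[OF fs, of m \<gamma>] by (intro insert_in_schreier_succ) auto
      have "\<exists>K. \<forall>m'\<ge>K. \<Phi> {m} \<le> \<Phi> (insert m {m'})"
      proof (rule less.IH[OF successor(1), where N = "Suc m"])
        fix s t assume st: "s \<in> schreier fs \<gamma>" "t \<in> schreier fs \<gamma>" "s \<noteq> {}" "finite t"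
          "Suc m \<le> Min t" "s \<subset> t"
        have "m \<notin> t" using st(4,5) by (metis Min_le not_less_eq_eq)
        moreover have "Min (insert m t) = m"
          using st(3-6) by (subst Min_insert) auto
        ultimately show "\<Phi> (insert m t) < \<Phi> (insert m s)"
          using st m Min_sub[of s t] by (intro less.prems(1) ins) auto
      qed (use \<open>\<not> \<gamma> \<le> \<Phi> {m}\<close> in simp)
      then obtain K where K: "\<And>m'. m' \<ge> K \<Longrightarrow> \<Phi> {m} \<le> \<Phi> {m, m'}" by blast
      define m' where "m' = max K (Suc m)"
      have "\<Phi> {m, m'} < \<Phi> {m}"
      proof (rule less.prems(1))
        show "{m, m'} \<in> schreier fs \<alpha>"
          using singleton_in_schreier[OF fs, of m' \<gamma>] by (intro ins) (auto simp: m'_def)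
        show "{m} \<in> schreier fs \<alpha>" using m by (intro singleton_in_schreier[OF fs]) auto
        show "{m} \<subset> {m, m'}" by (auto simp: m'_def)
        show "N \<le> Min {m, m'}" using m by (auto simp: m'_def)
      qed auto
      moreover have "\<Phi> {m} \<le> \<Phi> {m, m'}" by (rule K) (simp add: m'_def)
      ultimately show False by simp
    qed
    then show ?thesis using successor(2)[OF less.prems(2)] by (meson order_trans)
  qed
qed

section \<open>Countable bounds and rank functions in the first uncountable ordinal\<close>

lemma omega1_countable_bounded:
  fixes C :: "'o::wellorder set"
  assumes "omega1_type TYPE('o)" "countable C"
  obtains \<beta> where "\<And>c. c \<in> C \<Longrightarrow> c < \<beta>"
proof -
  have cnt: "countable {..c}" for c :: 'o
  proof -
    have "{..c} = insert c {\<alpha>. \<alpha> < c}" by auto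
    then show ?thesis using assms(1) unfolding omega1_type_def by (metis countable_insert)
  qed
  have "(\<Union>c\<in>C. {..c}) \<noteq> UNIV"
  proof
    assume "(\<Union>c\<in>C. {..c}) = UNIV"
    then have "countable (UNIV :: 'o set)" using assms(2) cnt by (metis countable_UN)
    then show False using assms(1) unfolding omega1_type_def by blast
  qed
  then obtain \<beta> where "\<beta> \<notin> (\<Union>c\<in>C. {..c})" by blast
  then show ?thesis using that[of \<beta>] by (auto simp: not_le)
qed

text \<open>The rank is the least strict bound of the ranks below. Such a bound exists because a
  node has only countably many nodes below it.\<close>

lemma wf_rank_omega1:
  assumes "omega1_type TYPE('o::wellorder)" "wf r" and "\<And>a. countable {b. (b, a) \<in> r}"
  obtains rk :: "'a \<Rightarrow> 'o::wellorder" where "\<And>a b. (b, a) \<in> r \<Longrightarrow> rk b < rk a"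
proof -
  define rk :: "'a \<Rightarrow> 'o" where "rk = wfrec r (\<lambda>f a. LEAST \<gamma>. \<forall>b. (b, a) \<in> r \<longrightarrow> f b < \<gamma>)"
  have rk: "rk a = (LEAST \<gamma>. \<forall>b. (b, a) \<in> r \<longrightarrow> rk b < \<gamma>)" for a
    unfolding rk_def by (subst wfrec[OF assms(2)]) (simp add: cut_apply cong: imp_cong)
  have "\<forall>b. (b, a) \<in> r \<longrightarrow> rk b < rk a" for a
  proof -
    obtain \<beta> where "\<And>c. c \<in> rk ` {b. (b, a) \<in> r} \<Longrightarrow> c < \<beta>"
      using omega1_countable_bounded[OF assms(1) countable_image[OF assms(3)]] by metis
    then have "\<forall>b. (b, a) \<in> r \<longrightarrow> rk b < \<beta>" by blast
    then have "\<forall>b. (b, a) \<in> r \<longrightarrow> rk b < (LEAST \<gamma>. \<forall>b. (b, a) \<in> r \<longrightarrow> rk b < \<gamma>)"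
      by (rule LeastI)
    then show ?thesis using rk[of a] by simp
  qed
  then show ?thesis using that by blast
qed

subsection \<open>The tree of partial embeddings\<close>

text \<open>Bounding the coefficients by \<open>card s\<close> makes the box finite for finite
  \<open>s\<close>, so only countably many maps lead from it to a countable set. Along a strictly
  growing chain the bound passes every integer.\<close>

definition coeff_box :: "nat set \<Rightarrow> (nat \<Rightarrow> int) set" where
  "coeff_box s = {x. \<forall>i. (i \<notin> s \<longrightarrow> x i = 0) \<and> \<bar>x i\<bar> \<le> int (card s)}"

lemma finite_coeff_box: "finite s \<Longrightarrow> finite (coeff_box s)"
  by (rule finite_subset[OF _ finite_set_of_finite_funs[of s "{- int (card s)..int (card s)}" 0]])
     (auto simp: coeff_box_def abs_le_iff minus_le_iff)

lemma coeff_box_subset_c00: "finite s \<Longrightarrow> coeff_box s \<subseteq> c00"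
  by (rule subsetI, simp add: coeff_box_def c00_def, rule finite_subset[of _ s]) auto

lemma coeff_box_mono:
  assumes "s \<subseteq> t" "finite t"
  shows "coeff_box s \<subseteq> coeff_box t"
proof -
  have "int (card s) \<le> int (card t)" using assms by (simp add: card_mono)
  then show ?thesis using assms(1) unfolding coeff_box_def by (auto intro: order_trans)
qed

text \<open>The supports may exhaust only an infinite subset \<open>S\<close> of the naturals.
  Relabelling coordinates by a bijection onto \<open>S\<close> embeds \<open>c00\<close>
  isometrically into the union of the boxes.\<close>

lemma chain_union_controlled:
  assumes s: "\<And>k. finite (s k)" "\<And>k. s k \<subset> s (Suc k)"
    and \<phi>: "\<And>k. \<phi> k ` coeff_box (s k) \<subseteq> D" "\<And>k. coarsely_controlled (coeff_box (s k)) d_inf d (\<phi> k) H"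
    and ext: "\<And>k x. x \<in> coeff_box (s k) \<Longrightarrow> \<phi> (Suc k) x = \<phi> k x"
  obtains \<Psi> where "\<Psi> ` c00 \<subseteq> D" "coarsely_controlled c00 d_inf d \<Psi> H"
proof -
  define S where "S = (\<Union>k. s k)"
  have mono: "s k \<subseteq> s l" if "k \<le> l" for k l
    using lift_Suc_mono_le[of s] s(2) that by blast
  have card: "k \<le> card (s k)" for k
  proof (induction k)
    case (Suc k)
    then show ?case using psubset_card_mono[OF s(1) s(2)[of k]] by linarith
  qed simp
  have "infinite S"
  proof
    assume "finite S"
    then have "card (s k) \<le> card S" for k by (intro card_mono) (auto simp: S_def)
    then show False using card[of "Suc (card S)"] by (metis not_less_eq_eq order_trans)
  qed
  then obtain e :: "nat \<Rightarrow> nat" where e: "bij_betw e UNIV S"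
    using bij_enumerate by blast
  then have inj: "inj e" and ran: "range e = S" by (auto simp: bij_betw_def)
  define T where "T x i = (if i \<in> S then x (inv e i) else 0)" for x :: "nat \<Rightarrow> int" and i
  have T_e: "T x (e n) = x n" for x n
    using inj ran by (auto simp: T_def)
  have fin_sub: "\<exists>k. A \<subseteq> s k" if "finite A" "A \<subseteq> S" for A
    using that
  proof (induction A rule: finite_induct)
    case (insert a A)
    then obtain k l where "A \<subseteq> s k" "a \<in> s l" by (auto simp: S_def)
    then have "insert a A \<subseteq> s (max k l)" using mono[of k "max k l"] mono[of l "max k l"] by auto
    then show ?case by blast
  qed simp
  have box_le: "coeff_box (s k) \<subseteq> coeff_box (s l)" if "k \<le> l" for k l
    using coeff_box_mono[OF mono[OF that] s(1)] .
  have T_box: "\<exists>k. T x \<in> coeff_box (s k)" if "x \<in> c00" for x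
  proof -
    let ?A = "{n. x n \<noteq> 0}"
    have fin: "finite ?A" using that by (simp add: c00_def)
    then obtain k where k: "e ` ?A \<subseteq> s k" using fin_sub[of "e ` ?A"] ran by blast
    \<comment> \<open>Index \<open>k\<close> captures the support and index \<open>b\<close> the
      coefficients, because \<open>b \<le> card (s b)\<close>; their maximum does both.\<close>
    define b where "b = nat (\<Sum>n\<in>?A. \<bar>x n\<bar>)"
    have "\<bar>x n\<bar> \<le> int b" for n
    proof (cases "n \<in> ?A")
      case True
      then have "\<bar>x n\<bar> \<le> (\<Sum>n\<in>?A. \<bar>x n\<bar>)" by (intro member_le_sum fin) auto
      then show ?thesis by (simp add: b_def)
    qed simp
    moreover have "b \<le> card (s (max k b))" using card[of "max k b"] by linarith
    ultimately have bound: "\<bar>x n\<bar> \<le> int (card (s (max k b)))" for n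
      by (meson of_nat_mono order_trans)
    have "T x \<in> coeff_box (s (max k b))"
      unfolding coeff_box_def
    proof (intro CollectI allI conjI impI)
      fix i
      show "T x i = 0" if "i \<notin> s (max k b)"
      proof (cases "i \<in> S")
        case True
        then obtain n where n: "i = e n" using ran by blast
        have "n \<notin> ?A" using k that mono[of k "max k b"] n by auto
        then show ?thesis using T_e n by simp
      qed (simp add: T_def)
      show "\<bar>T x i\<bar> \<le> int (card (s (max k b)))"
        using bound unfolding T_def by simp
    qed
    then show ?thesis by blast
  qed
  then obtain \<kappa> where \<kappa>: "\<And>x. x \<in> c00 \<Longrightarrow> T x \<in> coeff_box (s (\<kappa> x))" by metis
  have stable: "\<phi> l x = \<phi> k x" if "k \<le> l" "x \<in> coeff_box (s k)" for k l x
    using that(1)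
  proof (induction l rule: dec_induct)
    case (step l)
    then show ?case using ext[of x l] box_le[of k l] that(2) by auto
  qed simp
  \<comment> \<open>By \<open>stable\<close>, \<open>\<kappa> x\<close> may be replaced by any
    larger index, so two points can be compared in a common box.\<close>
  define \<Psi> where "\<Psi> x = \<phi> (\<kappa> x) (T x)" for x
  have "\<Psi> ` c00 \<subseteq> D" using \<kappa> \<phi>(1) unfolding \<Psi>_def by blast
  moreover have "coarsely_controlled c00 d_inf d \<Psi> H"
    unfolding coarsely_controlled_def
  proof (intro ballI)
    fix x y assume xy: "x \<in> c00" "y \<in> c00"
    define l where "l = max (\<kappa> x) (\<kappa> y)"
    have T_l: "T x \<in> coeff_box (s l)" "T y \<in> coeff_box (s l)"
      using \<kappa>[OF xy(1)] \<kappa>[OF xy(2)] box_le[of "\<kappa> x" l] box_le[of "\<kappa> y" l] by (auto simp: l_def)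
    have \<Psi>: "\<Psi> x = \<phi> l (T x)" "\<Psi> y = \<phi> l (T y)"
      unfolding \<Psi>_def using stable[OF _ \<kappa>[OF xy(1)], of l] stable[OF _ \<kappa>[OF xy(2)], of l]
      by (simp_all add: l_def)
    have Tc: "T x \<in> c00" "T y \<in> c00" using T_l coeff_box_subset_c00[OF s(1)] by blast+
    have "d_inf (T x) (T y) = d_inf x y"
    proof (rule antisym)
      show "d_inf (T x) (T y) \<le> d_inf x y"
        unfolding d_inf_le_iff[OF Tc]
      proof
        fix i
        show "real_of_int \<bar>T x i - T y i\<bar> \<le> d_inf x y"
          using le_d_inf[OF xy, of "inv e i"] d_inf_nonneg[OF xy] by (simp add: T_def)
      qed
      show "d_inf x y \<le> d_inf (T x) (T y)"
        unfolding d_inf_le_iff[OF xy]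
      proof
        fix n
        show "real_of_int \<bar>x n - y n\<bar> \<le> d_inf (T x) (T y)"
          using le_d_inf[OF Tc, of "e n"] by (simp only: T_e)
      qed
    qed
    moreover have "\<forall>n. (d_inf (T x) (T y) \<le> real n \<longrightarrow> d (\<phi> l (T x)) (\<phi> l (T y)) \<le> real (H n)) \<and>
      (real (H n) \<le> d_inf (T x) (T y) \<longrightarrow> real n \<le> d (\<phi> l (T x)) (\<phi> l (T y)))"
      using \<phi>(2)[of l] T_l unfolding coarsely_controlled_def by blast
    ultimately show "\<forall>n. (d_inf x y \<le> real n \<longrightarrow> d (\<Psi> x) (\<Psi> y) \<le> real (H n)) \<and>
      (real (H n) \<le> d_inf x y \<longrightarrow> real n \<le> d (\<Psi> x) (\<Psi> y))"
      unfolding \<Psi> by simp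
  qed
  ultimately show ?thesis using that by blast
qed

text \<open>The passage to uncountably many \<^term>\<open>\<alpha>\<close> with common moduli is the only use
  of Martin's axiom.\<close>

lemma uniform_schreier_embeddings:
  fixes fs :: "'o::wellorder \<Rightarrow> nat \<Rightarrow> 'o" and d :: "'m \<Rightarrow> 'm \<Rightarrow> real"
  assumes MA: "martins_axiom" and omega1: "omega1_type TYPE('o)"
    and notCH: "\<not> (UNIV :: real set) \<lesssim> (UNIV :: 'o set)"
    and emb: "\<And>\<alpha>::'o. coarsely_embeds (schreier_Z fs \<alpha>) d_inf M d"
  obtains H f and A :: "'o set" where "uncountable A"
    "\<And>\<alpha>. f \<alpha> ` (schreier_Z fs \<alpha> \<inter> c00) \<subseteq> M"
    "\<And>\<alpha>. \<alpha> \<in> A \<Longrightarrow> coarsely_controlled (schreier_Z fs \<alpha> \<inter> c00) d_inf d (f \<alpha>) H"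
proof -
  have "\<exists>f g. f ` (schreier_Z fs \<alpha> \<inter> c00) \<subseteq> M \<and>
      coarsely_controlled (schreier_Z fs \<alpha> \<inter> c00) d_inf d f g" for \<alpha>
  proof -
    obtain f where f: "coarse_embedding (schreier_Z fs \<alpha>) d_inf M d f"
      using emb[of \<alpha>] unfolding coarsely_embeds_def by blast
    then have "f ` schreier_Z fs \<alpha> \<subseteq> M" unfolding coarse_embedding_def by blast
    moreover obtain g where "coarsely_controlled (schreier_Z fs \<alpha> \<inter> c00) d_inf d f g"
      using coarse_embedding_imp_controlled[OF f, of "schreier_Z fs \<alpha> \<inter> c00"] d_inf_nonneg by blast
    ultimately show ?thesis by blast
  qed
  then obtain f g where f: "\<And>\<alpha>. f \<alpha> ` (schreier_Z fs \<alpha> \<inter> c00) \<subseteq> M"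
    and g: "\<And>\<alpha>. coarsely_controlled (schreier_Z fs \<alpha> \<inter> c00) d_inf d (f \<alpha>) (g \<alpha>)"
    by metis
  have unc: "uncountable (UNIV :: 'o set)" using omega1 unfolding omega1_type_def by blast
  obtain h where h: "\<And>\<alpha>. \<exists>N. \<forall>n\<ge>N. g \<alpha> n \<le> h n"
    using martins_axiom_dominating[OF MA uncountable_infinite[OF unc] notCH] by metis
  \<comment> \<open>The finitely many values before domination sets in are absorbed by a
    constant.\<close>
  have "\<exists>b. \<forall>n. g \<alpha> n \<le> h n + b" for \<alpha>
  proof -
    obtain N where N: "\<And>n. n \<ge> N \<Longrightarrow> g \<alpha> n \<le> h n" using h by blast
    have "g \<alpha> n \<le> h n + (\<Sum>n<N. g \<alpha> n)" for n
    proof (cases "n < N")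
      case True
      then have "g \<alpha> n \<le> (\<Sum>n<N. g \<alpha> n)" by (intro member_le_sum) auto
      then show ?thesis by simp
    next
      case False
      then show ?thesis using N[of n] by simp
    qed
    then show ?thesis by blast
  qed
  then obtain b where b: "\<And>\<alpha> n. g \<alpha> n \<le> h n + b \<alpha>" by metis
  \<comment> \<open>Countably many constants for uncountably many orders: one constant serves
    uncountably often.\<close>
  have "(UNIV :: 'o set) = (\<Union>v. b -` {v})" by auto
  then obtain v where "uncountable (b -` {v})"
    using unc by (metis countable_UN countableI_type)
  moreover have "coarsely_controlled (schreier_Z fs \<alpha> \<inter> c00) d_inf d (f \<alpha>) (\<lambda>n. h n + v)"
    if "\<alpha> \<in> b -` {v}" for \<alpha>
    using coarsely_controlled_mono[OF g, of \<alpha>] b[of \<alpha>] that by auto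
  ultimately show ?thesis using that f by blast
qed

text \<open>If the countable tree of nodes were well-founded, its ranks would stay below some
  \<open>\<beta>\<close>. For \<open>\<alpha>\<close> in \<open>A\<close> above
  \<open>\<beta>\<close>, restrictions of \<open>f \<alpha>\<close> copy the Schreier tree of order
  \<open>\<alpha>\<close> into it and force a rank of at least \<open>\<beta>\<close>.\<close>

proposition c00_controlled_if_schreier_embeds:
  fixes M :: "'m set" and d :: "'m \<Rightarrow> 'm \<Rightarrow> real" and fs :: "'o::wellorder \<Rightarrow> nat \<Rightarrow> 'o"
  assumes MA: "martins_axiom" and omega1: "omega1_type TYPE('o)"
    and notCH: "\<not> (UNIV :: real set) \<lesssim> (UNIV :: 'o set)"
    and fs: "fundamental_sequences fs"
    and M: "separable_metric_space M d"
    and emb: "\<And>\<alpha>::'o. coarsely_embeds (schreier_Z fs \<alpha>) d_inf M d"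
  obtains \<Psi> H where "\<Psi> ` c00 \<subseteq> M" "coarsely_controlled c00 d_inf d \<Psi> H"
proof -
  interpret Metric_space M d using M by (simp add: separable_metric_space_def)
  obtain D where D: "countable D" "D \<subseteq> M" "\<And>x e. \<lbrakk>x \<in> M; e > 0\<rbrakk> \<Longrightarrow> \<exists>c\<in>D. d x c < e"
    using separable_net M unfolding separable_metric_space_def by blast
  obtain H0 f0 and A :: "'o set" where A: "uncountable A"
    and f0: "\<And>\<alpha>. f0 \<alpha> ` (schreier_Z fs \<alpha> \<inter> c00) \<subseteq> M"
      "\<And>\<alpha>. \<alpha> \<in> A \<Longrightarrow> coarsely_controlled (schreier_Z fs \<alpha> \<inter> c00) d_inf d (f0 \<alpha>) H0"
    using uniform_schreier_embeddings[OF MA omega1 notCH emb] by metis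
  \<comment> \<open>Values in the countable net make the tree countable, at the cost of a larger
    modulus.\<close>
  define f where "f \<alpha> x = (SOME c. c \<in> D \<and> d (f0 \<alpha> x) c < 1)" for \<alpha> x
  have f: "f \<alpha> x \<in> D \<and> d (f0 \<alpha> x) (f \<alpha> x) < 1" if "x \<in> schreier_Z fs \<alpha> \<inter> c00" for \<alpha> x
  proof -
    have "f0 \<alpha> x \<in> M" using f0(1) that by blast
    then have "\<exists>c. c \<in> D \<and> d (f0 \<alpha> x) c < 1" using D(3)[of "f0 \<alpha> x" 1] by auto
    then show ?thesis unfolding f_def by (rule someI_ex)
  qed
  define H where "H n = max (H0 n + 2) (H0 (n + 2))" for n
  have fH: "coarsely_controlled (schreier_Z fs \<alpha> \<inter> c00) d_inf d (f \<alpha>) H" if "\<alpha> \<in> A" for \<alpha>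
    unfolding H_def
  proof (rule coarsely_controlled_perturb[OF f0(2)[OF that]])
    fix x assume "x \<in> schreier_Z fs \<alpha> \<inter> c00"
    then show "f0 \<alpha> x \<in> M \<and> f \<alpha> x \<in> M" "d (f0 \<alpha> x) (f \<alpha> x) < 1"
      using f0(1) f D(2) by blast+
  qed
  define node where "node = (\<lambda>(s, \<phi>). finite s \<and> \<phi> \<in> coeff_box s \<rightarrow>\<^sub>E D \<and> coarsely_controlled (coeff_box s) d_inf d \<phi> H)"
  \<comment> \<open>Extensions lie below what they extend, so a failure of well-foundedness is an
    infinite branch; strict inclusion makes its supports grow without bound.\<close>
  define r where "r = {((t, \<psi>), (s, \<phi>)). node (t, \<psi>) \<and> node (s, \<phi>) \<and> s \<subset> t \<and> \<phi> = restrict \<psi> (coeff_box s)}"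
  have cnt: "countable {p. node p}"
  proof (rule countable_subset)
    show "{p. node p} \<subseteq> (SIGMA s : Collect finite. coeff_box s \<rightarrow>\<^sub>E D)" by (auto simp: node_def)
    show "countable (SIGMA s : Collect finite :: nat set set. coeff_box s \<rightarrow>\<^sub>E D)"
      by (intro countable_SIGMA countable_Collect_finite countable_PiE) (auto simp: finite_coeff_box D(1))
  qed
  have "\<not> wf r"
  proof
    assume "wf r"
    moreover have "countable {b. (b, a) \<in> r}" for a
      by (rule countable_subset[OF _ cnt]) (auto simp: r_def)
    ultimately obtain rk :: "_ \<Rightarrow> 'o" where rk: "\<And>a b. (b, a) \<in> r \<Longrightarrow> rk b < rk a"
      using wf_rank_omega1[OF omega1] by metis
    obtain \<beta> where \<beta>: "\<And>p. node p \<Longrightarrow> rk p < \<beta>"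
      using omega1_countable_bounded[OF omega1 countable_image[OF cnt, of rk]] by (metis imageI mem_Collect_eq)
    have "\<exists>\<alpha>\<in>A. \<beta> < \<alpha>"
    proof (rule ccontr)
      assume "\<not> ?thesis"
      then have "A \<subseteq> insert \<beta> {\<alpha>. \<alpha> < \<beta>}" by (auto simp: not_less order_le_less)
      then show False
        using A omega1 unfolding omega1_type_def by (meson countable_insert countable_subset)
    qed
    then obtain \<alpha> where \<alpha>: "\<alpha> \<in> A" "\<beta> < \<alpha>" by blast
    define p where "p s = (s, restrict (f \<alpha>) (coeff_box s))" for s
    have node_p: "node (p s)" if s: "finite s" "s \<in> schreier fs \<alpha>" for s
    proof -
      have sub: "coeff_box s \<subseteq> schreier_Z fs \<alpha> \<inter> c00"
        using s coeff_box_subset_c00[OF s(1)] unfolding schreier_Z_def coeff_box_def by blast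
      have "coarsely_controlled (coeff_box s) d_inf d (f \<alpha>) H"
        by (rule coarsely_controlled_mono[OF fH[OF \<alpha>(1)] _ sub]) simp
      then have "coarsely_controlled (coeff_box s) d_inf d (restrict (f \<alpha>) (coeff_box s)) H"
        by (rule coarsely_controlled_cong) simp
      then show ?thesis using s(1) sub f unfolding node_def p_def by auto
    qed
    have "\<exists>K. \<forall>m\<ge>K. \<beta> \<le> rk (p {m})"
    proof (rule schreier_rank[OF fs _ \<alpha>(2)])
      fix s t assume st: "s \<in> schreier fs \<alpha>" "t \<in> schreier fs \<alpha>" "finite t" "s \<subset> t"
      then have "finite s" by (meson finite_subset psubset_imp_subset)
      have "coeff_box s \<subseteq> coeff_box t" using st by (intro coeff_box_mono) auto
      then have "restrict (restrict (f \<alpha>) (coeff_box t)) (coeff_box s) = restrict (f \<alpha>) (coeff_box s)"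
        by (auto simp: restrict_def fun_eq_iff)
      then have "(p t, p s) \<in> r"
        using node_p[OF \<open>finite s\<close> st(1)] node_p[OF st(3,2)] st(4)
        by (simp add: r_def p_def del: restrict_restrict)
      then show "rk (p t) < rk (p s)" by (rule rk)
    qed
    \<comment> \<open>The maximum with 1 avoids \<open>{0}\<close>, as the Schreier families start
      at 1.\<close>
    then obtain K where "\<beta> \<le> rk (p {max K 1})" by (meson max.cobounded1)
    moreover have "node (p {max K 1})"
      using singleton_in_schreier[OF fs] by (intro node_p) auto
    ultimately show False using \<beta> by (meson leD)
  qed
  then obtain q where q: "\<And>k. (q (Suc k), q k) \<in> r"
    unfolding wf_iff_no_infinite_down_chain by blast
  define s \<phi> where "s k = fst (q k)" and "\<phi> k = snd (q k)" for k
  have chain: "node (s k, \<phi> k) \<and> s k \<subset> s (Suc k) \<and> \<phi> k = restrict (\<phi> (Suc k)) (coeff_box (s k))" for k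
    using q[of k] unfolding r_def s_def \<phi>_def by auto
  obtain \<Psi> where "\<Psi> ` c00 \<subseteq> D" "coarsely_controlled c00 d_inf d \<Psi> H"
  proof (rule chain_union_controlled)
    fix k
    show "finite (s k)" "s k \<subset> s (Suc k)" "\<phi> k ` coeff_box (s k) \<subseteq> D"
      "coarsely_controlled (coeff_box (s k)) d_inf d (\<phi> k) H"
      using chain[of k] unfolding node_def by auto
    show "\<phi> (Suc k) x = \<phi> k x" if "x \<in> coeff_box (s k)" for x
      using chain[of k] that by (metis restrict_apply')
  qed
  then show ?thesis using that D(2) by blast
qed

text \<open>\<open>'o\<close> has the order type of \<open>\<omega>\<^sub>1\<close>, so
  \<open>notCH\<close> expresses the negation of the Continuum Hypothesis. The embedding passes
  through \<open>c00\<close>.\<close>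

theorem theoremB:
  fixes M :: "'m set" and d :: "'m \<Rightarrow> 'm \<Rightarrow> real"
    and fs :: "'o::wellorder \<Rightarrow> nat \<Rightarrow> 'o"
    and X :: "'x set" and dX :: "'x \<Rightarrow> 'x \<Rightarrow> real"
  assumes MA: "martins_axiom"
    and omega1: "omega1_type TYPE('o)"
    and notCH: "\<not> (UNIV :: real set) \<lesssim> (UNIV :: 'o set)"
    and fs: "fundamental_sequences fs"
    and M: "separable_metric_space M d"
    and emb: "\<forall>\<alpha>::'o. coarsely_embeds (schreier_Z fs \<alpha>) d_inf M d"
    and X: "separable_metric_space X dX"
  shows "coarsely_embeds X dX M d"
proof -
  interpret M: Metric_space M d using M by (simp add: separable_metric_space_def)
  interpret X: Metric_space X dX using X by (simp add: separable_metric_space_def)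
  obtain \<Psi> H where \<Psi>: "\<Psi> ` c00 \<subseteq> M" "coarsely_controlled c00 d_inf d \<Psi> H"
    using c00_controlled_if_schreier_embeds[OF MA omega1 notCH fs M spec[OF emb]] by metis
  obtain F where F: "F ` X \<subseteq> c00" "coarsely_controlled X dX d_inf F (\<lambda>n. 5 * n + 5)"
    using X.aharoni_coarse X unfolding separable_metric_space_def by metis
  have "coarse_embedding X dX M d (\<Psi> \<circ> F)"
    using F(1) \<Psi>(1) coarsely_controlled_comp[OF F(2) \<Psi>(2) F(1)]
    by (intro controlled_imp_coarse_embedding) auto
  then show ?thesis unfolding coarsely_embeds_def by blast
qed

end
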